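(* Let $L=\langle a,t \mid a^2,\ [t^{i}at^{-i},t^{j}at^{-j}],\ i,j\in\mathbb{Z}\rangle$ be the lamplighter group. For every $w\in L$, the word length of $w$ with respect to the generating set $\{t,ta\}$ is equal to $D'(w)$, where $D'(w)$ is defined from the normal form of $w$ as follows. Write $a_k=t^kat^{-k}$ and $$w=a_{i_1}a_{i_2}\cdots a_{i_m}a_{-j_1}a_{-j_2}\cdots a_{-j_l}t^{r},\qquad 0<i_1<i_2<\cdots<i_m,\quad 0\le j_1<j_2<\cdots<j_l,\quad r\in\mathbb{Z},\ m,l\ge 0 .$$ If $l=0$, then $D'(w)=i_m+|r-i_m|$. If $l>0$, then $$D'(w)=\min\{\,2(j_l+1)+i_m+|r-i_m|,\ \ 2i_m+j_l+1+|r+j_l+1|\,\}.$$ Here $i_m$ is read as $0$ when $m=0$.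
   Context: The group $L$ is the wreath product $\mathbb{Z}_2\wr\mathbb{Z}$. Every $w\in L$ can be written in exactly one way in the displayed normal form (with $m=0$ or $l=0$ allowed, meaning that the corresponding block of letters is empty). The word length of $w$ with respect to a finite generating set $X$ is the least $n$ such that $w$ is a product of $n$ elements of $X\cup X^{-1}$. *)

theory Defs
  imports "HOL-Algebra.Group"
begin

section \<open>Group presentations\<close>

text \<open>The letter \<open>(g, True)\<close> stands for the generator \<open>g\<close>, and \<open>(g, False)\<close> for its formal
  inverse.\<close>

type_synonym 'g word = "('g \<times> bool) list"

definition word_inv :: "'g word \<Rightarrow> 'g word" where
  "word_inv u = rev (map (\<lambda>(g, b). (g, \<not> b)) u)"

definition word_pow :: "'g \<Rightarrow> int \<Rightarrow> 'g word" where
  "word_pow g k = replicate (nat \<bar>k\<bar>) (g, 0 \<le> k)"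

definition word_comm :: "'g word \<Rightarrow> 'g word \<Rightarrow> 'g word" where
  "word_comm u v = u @ v @ word_inv u @ word_inv v"

inductive pres_eq :: "'g word set \<Rightarrow> 'g word \<Rightarrow> 'g word \<Rightarrow> bool" for R where
  refl: "pres_eq R u u"
| sym: "pres_eq R u v \<Longrightarrow> pres_eq R v u"
| trans: "pres_eq R u v \<Longrightarrow> pres_eq R v w \<Longrightarrow> pres_eq R u w"
| cancel: "pres_eq R (u @ [(g, b), (g, \<not> b)] @ v) (u @ v)"
| relator: "\<rho> \<in> R \<Longrightarrow> pres_eq R (u @ \<rho> @ v) (u @ v)"

definition pres_rel :: "'g word set \<Rightarrow> ('g word \<times> 'g word) set" where
  "pres_rel R = {(u, v). pres_eq R u v}"

definition pres_class :: "'g word set \<Rightarrow> 'g word \<Rightarrow> 'g word set" where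
  "pres_class R u = pres_rel R `` {u}"

text \<open>The group with the given relators in which every element of the type \<open>'g\<close> is a
  generator.\<close>

definition presented_group :: "'g word set \<Rightarrow> 'g word set monoid" where
  "presented_group R =
    \<lparr>carrier = UNIV // pres_rel R,
     mult = (\<lambda>U V. \<Union>u\<in>U. \<Union>v\<in>V. pres_class R (u @ v)),
     one = pres_class R []\<rparr>"

lemma equiv_pres_rel: "equiv UNIV (pres_rel R)"
proof (rule equivI)
  show "trans (pres_rel R)"
    unfolding pres_rel_def trans_def using pres_eq.trans by blast
  show "sym (pres_rel R)"
    unfolding pres_rel_def sym_def using pres_eq.sym by blast
  show "refl (pres_rel R)"
    unfolding pres_rel_def refl_on_def using pres_eq.refl by blast
qed simp

lemma pres_class_eq_iff: "pres_class R u = pres_class R v \<longleftrightarrow> pres_eq R u v"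
  unfolding pres_class_def
  using eq_equiv_class_iff[OF equiv_pres_rel, of u v R] by (auto simp: pres_rel_def)

lemma pres_eq_context: "pres_eq R u v \<Longrightarrow> pres_eq R (x @ u @ y) (x @ v @ y)"
proof (induction rule: pres_eq.induct)
  case (cancel u g b v)
  show ?case using pres_eq.cancel[of R "x @ u" g b "v @ y"] by simp
next
  case (relator \<rho> u v)
  then show ?case using pres_eq.relator[of \<rho> R "x @ u" "v @ y"] by simp
next
  case (trans u v w)
  from trans.IH show ?case by (rule pres_eq.trans)
next
  case (sym u v)
  from sym.IH show ?case by (rule pres_eq.sym)
qed (rule pres_eq.refl)

lemma pres_eq_append:
  assumes "pres_eq R u u'" "pres_eq R v v'"
  shows "pres_eq R (u @ v) (u' @ v')"
proof (rule pres_eq.trans)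
  show "pres_eq R (u @ v) (u' @ v)"
    using pres_eq_context[OF assms(1), of "[]" v] by simp
  show "pres_eq R (u' @ v) (u' @ v')"
    using pres_eq_context[OF assms(2), of u' "[]"] by simp
qed

lemma carrier_presented_group: "carrier (presented_group R) = range (pres_class R)"
  by (auto simp: presented_group_def quotient_def pres_class_def)

lemma one_presented_group: "\<one>\<^bsub>presented_group R\<^esub> = pres_class R []"
  by (simp add: presented_group_def)

lemma mult_presented_group:
  "pres_class R u \<otimes>\<^bsub>presented_group R\<^esub> pres_class R v = pres_class R (u @ v)"
proof -
  have *: "pres_class R (u' @ v') = pres_class R (u @ v)"
    if "u' \<in> pres_class R u" "v' \<in> pres_class R v" for u' v'
  proof -
    have "pres_eq R u u'" "pres_eq R v v'"
      using that by (auto simp: pres_class_def pres_rel_def)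
    then have "pres_eq R (u @ v) (u' @ v')" by (rule pres_eq_append)
    then show ?thesis by (simp flip: pres_class_eq_iff)
  qed
  have "u \<in> pres_class R u" "v \<in> pres_class R v"
    by (simp_all add: pres_class_def pres_rel_def pres_eq.refl)
  with * show ?thesis
    unfolding presented_group_def monoid.simps by blast
qed

lemma pres_eq_word_inv: "pres_eq R (word_inv u @ u) []"
proof (induction u)
  case Nil
  show ?case by (simp add: word_inv_def pres_eq.refl)
next
  case (Cons x u)
  obtain g b where x: "x = (g, b)" by (cases x)
  have "pres_eq R (word_inv (x # u) @ x # u) (word_inv u @ u)"
    using pres_eq.cancel[of R "word_inv u" g "\<not> b" u] by (simp add: x word_inv_def)
  then show ?case using Cons.IH by (rule pres_eq.trans)
qed

lemma group_presented_group: "group (presented_group R)"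
proof (rule groupI)
  fix x assume "x \<in> carrier (presented_group R)"
  then obtain u where x: "x = pres_class R u" unfolding carrier_presented_group by blast
  have "pres_class R (word_inv u) \<otimes>\<^bsub>presented_group R\<^esub> x = \<one>\<^bsub>presented_group R\<^esub>"
    unfolding x mult_presented_group one_presented_group pres_class_eq_iff
    by (rule pres_eq_word_inv)
  then show "\<exists>y\<in>carrier (presented_group R). y \<otimes>\<^bsub>presented_group R\<^esub> x = \<one>\<^bsub>presented_group R\<^esub>"
    unfolding carrier_presented_group by blast
qed (auto simp: carrier_presented_group mult_presented_group one_presented_group)


section \<open>Word length\<close>

text \<open>Meaningful only for elements of the subgroup generated by \<open>X\<close>.\<close>

definition word_length :: "('a, 'b) monoid_scheme \<Rightarrow> 'a set \<Rightarrow> 'a \<Rightarrow> nat" where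
  "word_length G X x =
    (LEAST n. \<exists>xs. set xs \<subseteq> X \<union> m_inv G ` X \<and> length xs = n \<and> foldr (mult G) xs \<one>\<^bsub>G\<^esub> = x)"


section \<open>The lamplighter group\<close>

datatype lamp_gen = A | T

definition lamp_word :: "int \<Rightarrow> lamp_gen word" where
  "lamp_word k = word_pow T k @ [(A, True)] @ word_pow T (- k)"

definition lamplighter_relators :: "lamp_gen word set" where
  "lamplighter_relators =
    insert (word_pow A 2) {word_comm (lamp_word i) (lamp_word j) | i j. True}"

definition lamplighter :: "lamp_gen word set monoid" where
  "lamplighter = presented_group lamplighter_relators"

definition gen_a :: "lamp_gen word set" where
  "gen_a = pres_class lamplighter_relators [(A, True)]"

definition gen_t :: "lamp_gen word set" where
  "gen_t = pres_class lamplighter_relators [(T, True)]"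

definition lamp :: "int \<Rightarrow> lamp_gen word set" where
  "lamp k = gen_t [^]\<^bsub>lamplighter\<^esub> k \<otimes>\<^bsub>lamplighter\<^esub> gen_a
     \<otimes>\<^bsub>lamplighter\<^esub> gen_t [^]\<^bsub>lamplighter\<^esub> (- k)"

text \<open>The triple \<open>(is, js, r)\<close> consists of the exponent lists \<open>i\<^sub>1, \<dots>, i\<^sub>m\<close> and
  \<open>j\<^sub>1, \<dots>, j\<^sub>l\<close> and the final exponent of \<open>t\<close>.\<close>

definition is_normal_form :: "lamp_gen word set \<Rightarrow> int list \<times> int list \<times> int \<Rightarrow> bool" where
  "is_normal_form w = (\<lambda>(is, js, r).
     sorted_wrt (<) is \<and> (\<forall>i\<in>set is. 0 < i) \<and>
     sorted_wrt (<) js \<and> (\<forall>j\<in>set js. 0 \<le> j) \<and>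
     w = foldr (mult lamplighter) (map lamp is @ map (\<lambda>j. lamp (- j)) js)
           (gen_t [^]\<^bsub>lamplighter\<^esub> r))"

definition normal_form :: "lamp_gen word set \<Rightarrow> int list \<times> int list \<times> int" where
  "normal_form w = (THE nf. is_normal_form w nf)"

definition D' :: "lamp_gen word set \<Rightarrow> int" where
  "D' w = (case normal_form w of (is, js, r) \<Rightarrow>
     let im = (if is = [] then 0 else last is) in
     if js = [] then im + \<bar>r - im\<bar>
     else let jl = last js in
       min (2 * (jl + 1) + im + \<bar>r - im\<bar>) (2 * im + jl + 1 + \<bar>r + jl + 1\<bar>))"

end

theory Submission
  imports Defs "HOL-Library.Multiset"
begin

text \<open>Words act on states \<open>(S, p)\<close>, where \<open>S\<close> is the set of lit lamps and \<open>p\<close> the position of the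
  lamplighter: \<open>t\<close> moves right and \<open>a\<close> toggles the lamp at \<open>p\<close>. Two words represent the same element
  iff they lead from \<open>({}, 0)\<close> to the same state. The generators \<open>t\<close> and \<open>ta\<close> cross the edge from
  \<open>p\<close> to \<open>p + 1\<close> and may toggle the lamp \<open>p + 1\<close> on the way, so lamp \<open>k\<close> belongs to the edge from
  \<open>k - 1\<close> to \<open>k\<close>, and the word length is the length of a shortest walk in \<open>\<int>\<close> from \<open>0\<close> to \<open>p\<close> that
  crosses all the edges of lit lamps.\<close>

section \<open>The action of words on lamp configurations\<close>

fun step :: "int set \<times> int \<Rightarrow> lamp_gen \<times> bool \<Rightarrow> int set \<times> int" where
  "step (S, p) (A, b) = (sym_diff S {p}, p)"
| "step (S, p) (T, b) = (S, p + (if b then 1 else - 1))"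

abbreviation run :: "int set \<times> int \<Rightarrow> lamp_gen word \<Rightarrow> int set \<times> int" where
  "run \<equiv> foldl step"

lemma sym_diff_cancel: "sym_diff (sym_diff S X) X = S"
  by auto

lemma step_inverse: "step (step s (g, b)) (g, \<not> b) = s"
proof -
  obtain S p where s: "s = (S, p)" by (cases s)
  show ?thesis
    by (cases g) (simp_all only: s step.simps sym_diff_cancel, simp)
qed

lemma run_word_inv: "run s (u @ word_inv u) = s"
proof (induction u arbitrary: s)
  case Nil
  show ?case by (simp add: word_inv_def)
next
  case (Cons x u)
  obtain g b where x: "x = (g, b)" by (cases x)
  have "run s ((x # u) @ word_inv (x # u)) = step (run (step s x) (u @ word_inv u)) (g, \<not> b)"
    by (simp add: x word_inv_def)
  then show ?case by (simp only: Cons.IH) (simp add: x step_inverse)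
qed

lemma run_replicate_T:
  "run (S, p) (replicate n (T, b)) = (S, p + (if b then int n else - int n))"
  by (induction n arbitrary: p) auto

lemma run_word_pow_T: "run (S, p) (word_pow T k) = (S, p + k)"
  by (simp add: word_pow_def run_replicate_T)

lemma run_lamp_word: "run (S, p) (lamp_word k) = (sym_diff S {p + k}, p)"
  by (simp add: lamp_word_def run_word_pow_T)

text \<open>The toggled state is the one that \<open>lamp_word k\<close> carries to
  \<open>(S, p)\<close>, so undoing that word from \<open>(S, p)\<close> leads back to it.\<close>

lemma run_word_inv_lamp_word: "run (S, p) (word_inv (lamp_word k)) = (sym_diff S {p + k}, p)"
proof -
  have "run (run (sym_diff S {p + k}, p) (lamp_word k)) (word_inv (lamp_word k))
    = (sym_diff S {p + k}, p)"
    using run_word_inv by simp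
  then show ?thesis unfolding run_lamp_word sym_diff_cancel .
qed

lemma run_relator:
  assumes "\<rho> \<in> lamplighter_relators"
  shows "run s \<rho> = s"
proof -
  obtain S p where s: "s = (S, p)" by (cases s)
  consider "\<rho> = word_pow A 2" | i j where "\<rho> = word_comm (lamp_word i) (lamp_word j)"
    using assms by (auto simp: lamplighter_relators_def)
  then show ?thesis
  proof cases
    case 1
    then show ?thesis by (auto simp: s word_pow_def numeral_2_eq_2)
  next
    case 2
    have "sym_diff (sym_diff (sym_diff (sym_diff S {p + i}) {p + j}) {p + i}) {p + j} = S"
      by auto
    with 2 show ?thesis
      by (simp only: s word_comm_def foldl_append run_lamp_word run_word_inv_lamp_word)
  qed
qed

lemma run_cong: "pres_eq lamplighter_relators u v \<Longrightarrow> run s u = run s v"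
proof (induction arbitrary: s rule: pres_eq.induct)
  case (cancel u g b v)
  show ?case by (simp add: step_inverse)
next
  case (relator \<rho> u v)
  then show ?case by (simp add: run_relator)
qed simp_all

text \<open>Finiteness of the set of lit lamps is what lets a normal form list it in increasing
  order.\<close>

lemma finite_run: "finite S \<Longrightarrow> finite (fst (run (S, p) u))"
proof (induction u rule: rev_induct)
  case (snoc x u)
  then show ?case
    by (cases "run (S, p) u"; cases x; cases "fst x") auto
qed simp


section \<open>Words in the lamplighter group\<close>

abbreviation cls :: "lamp_gen word \<Rightarrow> lamp_gen word set" where
  "cls \<equiv> pres_class lamplighter_relators"

lemma group_lamplighter: "group lamplighter"
  by (simp add: lamplighter_def group_presented_group)

lemma cls_in_carrier: "cls u \<in> carrier lamplighter"
  by (simp add: lamplighter_def carrier_presented_group)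

lemma mult_cls: "cls u \<otimes>\<^bsub>lamplighter\<^esub> cls v = cls (u @ v)"
  by (simp add: lamplighter_def mult_presented_group)

lemma one_cls: "\<one>\<^bsub>lamplighter\<^esub> = cls []"
  by (simp add: lamplighter_def one_presented_group)

lemma inv_cls: "inv\<^bsub>lamplighter\<^esub> (cls u) = cls (word_inv u)"
proof (rule group.inv_equality[OF group_lamplighter])
  show "cls (word_inv u) \<otimes>\<^bsub>lamplighter\<^esub> cls u = \<one>\<^bsub>lamplighter\<^esub>"
    by (simp add: mult_cls one_cls pres_class_eq_iff pres_eq_word_inv)
qed (simp_all add: cls_in_carrier)

lemma cls_context: "cls u = cls v \<Longrightarrow> cls (x @ u @ y) = cls (x @ v @ y)"
  by (simp add: pres_class_eq_iff pres_eq_context)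

lemma cls_append: "cls u = cls u' \<Longrightarrow> cls v = cls v' \<Longrightarrow> cls (u @ v) = cls (u' @ v')"
  by (simp add: pres_class_eq_iff pres_eq_append)

lemma foldr_mult_cls: "foldr (monoid.mult lamplighter) (map cls us) (cls v) = cls (concat us @ v)"
  by (induction us) (simp_all add: mult_cls)

lemma nat_pow_cls: "cls [x] [^]\<^bsub>lamplighter\<^esub> (n::nat) = cls (replicate n x)"
proof (induction n)
  case 0
  show ?case by (simp add: one_cls)
next
  case (Suc n)
  then show ?case by (simp add: mult_cls replicate_append_same)
qed

lemma gen_t_int_pow: "gen_t [^]\<^bsub>lamplighter\<^esub> (k::int) = cls (word_pow T k)"
proof (cases "k < 0")
  case True
  have "gen_t [^]\<^bsub>lamplighter\<^esub> k = inv\<^bsub>lamplighter\<^esub> (gen_t [^]\<^bsub>lamplighter\<^esub> nat (- k))"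
    unfolding int_pow_def2 using True by (rule if_P)
  also have "\<dots> = cls (word_pow T k)"
    using True by (simp add: gen_t_def nat_pow_cls inv_cls word_inv_def word_pow_def)
  finally show ?thesis .
next
  case False
  have "gen_t [^]\<^bsub>lamplighter\<^esub> k = gen_t [^]\<^bsub>lamplighter\<^esub> nat k"
    unfolding int_pow_def2 using False by (rule if_not_P)
  with False show ?thesis by (simp add: gen_t_def nat_pow_cls word_pow_def)
qed

lemma lamp_eq_cls: "lamp k = cls (lamp_word k)"
  by (simp add: lamp_def gen_t_int_pow gen_a_def mult_cls lamp_word_def)

text \<open>Taken from the power law of the group, which avoids cancelling letters by cases on the
  signs of \<open>i\<close> and \<open>j\<close>.\<close>

lemma cls_word_pow_add: "cls (word_pow T i @ word_pow T j) = cls (word_pow T (i + j))"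
proof -
  have "gen_t [^]\<^bsub>lamplighter\<^esub> (i + j) = gen_t [^]\<^bsub>lamplighter\<^esub> i \<otimes>\<^bsub>lamplighter\<^esub> gen_t [^]\<^bsub>lamplighter\<^esub> j"
    by (rule group.int_pow_mult[OF group_lamplighter]) (simp add: gen_t_def cls_in_carrier)
  then show ?thesis by (simp add: gen_t_int_pow mult_cls)
qed

lemma cls_lamp_word_commute: "cls (lamp_word i @ lamp_word j) = cls (lamp_word j @ lamp_word i)"
proof -
  let ?u = "lamp_word i" and ?v = "lamp_word j"
  have cancel: "cls (word_inv w @ w) = cls []" for w
    by (simp add: pres_class_eq_iff pres_eq_word_inv)
  have "word_comm ?u ?v \<in> lamplighter_relators"
    by (auto simp: lamplighter_relators_def)
  then have "cls (word_comm ?u ?v) = cls []"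
    using pres_eq.relator[of "word_comm ?u ?v" lamplighter_relators "[]" "[]"]
    by (simp add: pres_class_eq_iff)
  \<comment> \<open>The trivial commutator is put in front of \<open>?v @ ?u\<close>; cancelling the
    two inverses in turn leaves \<open>?u @ ?v\<close>.\<close>
  from cls_context[OF this, of "[]" "?v @ ?u"]
  have "cls (?v @ ?u) = cls ((?u @ ?v @ word_inv ?u) @ (word_inv ?v @ ?v) @ ?u)"
    by (simp add: word_comm_def)
  also have "\<dots> = cls ((?u @ ?v) @ (word_inv ?u @ ?u) @ [])"
    using cls_context[OF cancel, of "?u @ ?v @ word_inv ?u" ?v ?u] by simp
  also have "\<dots> = cls (?u @ ?v)"
    using cls_context[OF cancel, of "?u @ ?v" ?u "[]"] by simp
  finally show ?thesis ..
qed

text \<open>Evaluate a^-1 a a in two ways: the relator a^2 gives a^-1, free cancellation gives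
  a.\<close>

lemma cls_A: "cls [(A, b)] = cls [(A, True)]"
proof (cases b)
  case False
  have "pres_eq lamplighter_relators ([(A, False)] @ word_pow A 2 @ []) ([(A, False)] @ [])"
    by (rule pres_eq.relator) (simp add: lamplighter_relators_def)
  moreover have "pres_eq lamplighter_relators ([] @ [(A, False), (A, \<not> False)] @ [(A, True)])
    ([] @ [(A, True)])"
    by (rule pres_eq.cancel)
  ultimately show ?thesis
    using False
    by (simp add: word_pow_def numeral_2_eq_2 flip: pres_class_eq_iff)
qed simp

lemma cls_A_square: "cls [(A, True), (A, True)] = cls []"
  using pres_eq.relator[of "word_pow A 2" lamplighter_relators "[]" "[]"]
  by (simp add: lamplighter_relators_def word_pow_def numeral_2_eq_2 pres_class_eq_iff)

text \<open>Inserting t^-p t^p after the letter turns it into a lamp and moves the power of t to the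
  end.\<close>

lemma cls_word_pow_A: "cls (word_pow T p @ [(A, b)]) = cls (lamp_word p @ word_pow T p)"
proof -
  have "cls (word_pow T p @ [(A, b)]) = cls (word_pow T p @ [(A, True)] @ [])"
    using cls_context[OF cls_A, of "word_pow T p" b "[]"] by simp
  also have "\<dots> = cls ((word_pow T p @ [(A, True)]) @ (word_pow T (- p) @ word_pow T p) @ [])"
    using cls_context[OF cls_word_pow_add, of "word_pow T p @ [(A, True)]" "- p" p "[]"]
    by (simp add: word_pow_def)
  finally show ?thesis by (simp add: lamp_word_def)
qed

lemma cls_lamp_word_square: "cls (lamp_word p @ lamp_word p) = cls []"
proof -
  have "cls (lamp_word p @ lamp_word p) =
      cls ((lamp_word p @ word_pow T p) @ [(A, True)] @ word_pow T (- p))"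
    by (simp add: lamp_word_def)
  also have "\<dots> = cls ((word_pow T p @ [(A, True)]) @ [(A, True)] @ word_pow T (- p))"
    by (intro cls_append[OF cls_word_pow_A[symmetric] HOL.refl])
  also have "\<dots> = cls (word_pow T p @ [] @ word_pow T (- p))"
    using cls_context[OF cls_A_square] by simp
  also have "\<dots> = cls []"
    using cls_word_pow_add[of p "- p"] by (simp add: word_pow_def)
  finally show ?thesis .
qed

section \<open>Collecting lamps and solving the word problem\<close>

abbreviation lamps_word :: "int list \<Rightarrow> lamp_gen word" where
  "lamps_word ks \<equiv> concat (map lamp_word ks)"

lemma cls_lamps_word_snoc: "cls (lamps_word ks @ lamp_word k) = cls (lamp_word k @ lamps_word ks)"
proof (induction ks)
  case (Cons i ks)
  have "cls (lamps_word (i # ks) @ lamp_word k) = cls (lamp_word i @ lamp_word k @ lamps_word ks)"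
    using cls_append[OF HOL.refl Cons.IH, of "lamp_word i"] by simp
  also have "\<dots> = cls (lamp_word k @ lamp_word i @ lamps_word ks)"
    using cls_append[OF cls_lamp_word_commute HOL.refl, of i k] by simp
  finally show ?case by simp
qed simp

text \<open>Lamps commute, so the head \<open>k\<close> can be pulled to the front of
  \<open>ls\<close>; the remaining lists again have equal multisets.\<close>

lemma cls_lamps_word_cong:
  "mset ks = mset ls \<Longrightarrow> cls (lamps_word ks) = cls (lamps_word ls)"
proof (induction ks arbitrary: ls)
  case (Cons k ks)
  then have "k \<in> set ls" by (metis list.set_intros(1) set_mset_mset)
  then obtain xs ys where ls: "ls = xs @ k # ys" by (meson split_list)
  with Cons.prems have "mset ks = mset (xs @ ys)" by simp
  then have "cls (lamps_word ks) = cls (lamps_word (xs @ ys))" by (rule Cons.IH)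
  from cls_append[OF HOL.refl this, of "lamp_word k"]
  have "cls (lamps_word (k # ks)) = cls ((lamp_word k @ lamps_word xs) @ lamps_word ys)"
    by simp
  also have "\<dots> = cls ((lamps_word xs @ lamp_word k) @ lamps_word ys)"
    by (intro cls_append[OF cls_lamps_word_snoc[symmetric] HOL.refl])
  finally show ?case by (simp add: ls)
qed simp

lemma cls_lamps_word_cong_set:
  assumes "distinct ks" "distinct ls" "set ks = set ls"
  shows "cls (lamps_word ks) = cls (lamps_word ls)"
  using assms by (intro cls_lamps_word_cong) (simp add: set_eq_iff_mset_eq_distinct)

text \<open>Letter by letter, \<open>T\<close> changes only the final power, while \<open>A\<close>
  at position \<open>p\<close> contributes the lamp at \<open>p\<close>, which is either new or
  cancels. Hence the final state determines the class.\<close>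

lemma exists_lamps_word:
  "\<exists>ks. distinct ks \<and> set ks = fst (run ({}, 0) u) \<and>
     cls u = cls (lamps_word ks @ word_pow T (snd (run ({}, 0) u)))"
proof (induction u rule: rev_induct)
  case Nil
  show ?case by (rule exI[of _ "[]"]) (simp add: word_pow_def)
next
  case (snoc x u)
  obtain S p where run_u: "run ({}, 0) u = (S, p)" by (cases "run ({}, 0) u")
  with snoc.IH obtain ks where ks: "distinct ks" "set ks = S"
    "cls u = cls (lamps_word ks @ word_pow T p)" by auto
  obtain g b where x: "x = (g, b)" by (cases x)
  show ?case
  proof (cases g)
    case A
    have "cls (u @ [x]) = cls (lamps_word ks @ word_pow T p @ [x])"
      using cls_append[OF ks(3) HOL.refl, of "[x]"] by simp
    also have "\<dots> = cls (lamps_word ks @ lamp_word p @ word_pow T p)"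
      using cls_append[OF HOL.refl cls_word_pow_A] by (simp add: x A)
    finally have u: "cls (u @ [x]) = cls ((lamps_word ks @ lamp_word p) @ word_pow T p)"
      by simp
    show ?thesis
    proof (cases "p \<in> S")
      case True
      \<comment> \<open>The lamp \<open>p\<close> already present is moved to the end, where it
        meets its second copy and cancels.\<close>
      have "cls (lamps_word ks @ lamp_word p) = cls (lamps_word (remove1 p ks @ [p]) @ lamp_word p)"
        using True ks by (intro cls_append[OF cls_lamps_word_cong HOL.refl]) simp
      also have "\<dots> = cls (lamps_word (remove1 p ks))"
        using cls_context[OF cls_lamp_word_square, of "lamps_word (remove1 p ks)" p "[]"] by simp
      finally have "cls (lamps_word ks @ lamp_word p) = cls (lamps_word (remove1 p ks))" .
      with u have "cls (u @ [x]) = cls (lamps_word (remove1 p ks) @ word_pow T p)"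
        using cls_append[OF _ HOL.refl] by metis
      with True ks show ?thesis
        by (intro exI[of _ "remove1 p ks"]) (simp add: run_u x A)
    next
      case False
      with u ks show ?thesis
        by (intro exI[of _ "ks @ [p]"]) (auto simp: run_u x A)
    qed
  next
    case T
    have "[x] = word_pow T (if b then 1 else - 1)" by (simp add: x T word_pow_def)
    then have "cls (u @ [x]) = cls (lamps_word ks @ word_pow T p @ word_pow T (if b then 1 else - 1))"
      using cls_append[OF ks(3) HOL.refl, of "[x]"] by simp
    also have "\<dots> = cls (lamps_word ks @ word_pow T (p + (if b then 1 else - 1)))"
      by (intro cls_append[OF HOL.refl cls_word_pow_add])
    finally show ?thesis
      using ks by (intro exI[of _ ks]) (simp add: run_u x T)
  qed
qed

lemma cls_eq_iff_run: "cls u = cls v \<longleftrightarrow> run ({}, 0) u = run ({}, 0) v"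
proof
  assume "cls u = cls v"
  then show "run ({}, 0) u = run ({}, 0) v" by (simp add: pres_class_eq_iff run_cong)
next
  assume eq: "run ({}, 0) u = run ({}, 0) v"
  obtain ks where ks: "distinct ks" "set ks = fst (run ({}, 0) u)"
    "cls u = cls (lamps_word ks @ word_pow T (snd (run ({}, 0) u)))"
    using exists_lamps_word by blast
  obtain ls where ls: "distinct ls" "set ls = fst (run ({}, 0) v)"
    "cls v = cls (lamps_word ls @ word_pow T (snd (run ({}, 0) v)))"
    using exists_lamps_word by blast
  show "cls u = cls v"
    unfolding ks(3) ls(3) eq
    using ks(1,2) ls(1,2) eq by (intro cls_append cls_lamps_word_cong_set) auto
qed


section \<open>Normal forms\<close>

lemma run_lamps_word:
  "distinct ks \<Longrightarrow> set ks \<inter> S = {} \<Longrightarrow> run (S, 0) (lamps_word ks) = (S \<union> set ks, 0)"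
proof (induction ks arbitrary: S)
  case (Cons k ks)
  then have "sym_diff S {k} = insert k S" by auto
  with Cons show ?case by (simp add: run_lamp_word)
qed simp

text \<open>By \<open>cls_eq_iff_run\<close>, existence and uniqueness of normal forms reduce to
  splitting a finite set of integers by sign.\<close>

lemma is_normal_form_cls_iff:
  "is_normal_form (cls u) (is, js, r) \<longleftrightarrow>
     sorted_wrt (<) is \<and> (\<forall>i\<in>set is. 0 < i) \<and> sorted_wrt (<) js \<and> (\<forall>j\<in>set js. 0 \<le> j) \<and>
     run ({}, 0) u = (set is \<union> uminus ` set js, r)"
proof -
  have "foldr (monoid.mult lamplighter) (map lamp is @ map (\<lambda>j. lamp (- j)) js)
      (gen_t [^]\<^bsub>lamplighter\<^esub> r) = cls (lamps_word (is @ map uminus js) @ word_pow T r)"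
    using foldr_mult_cls[of "map lamp_word is @ map (\<lambda>j. lamp_word (- j)) js" "word_pow T r"]
    by (simp add: lamp_eq_cls[abs_def] gen_t_int_pow comp_def)
  moreover have "run ({}, 0) (lamps_word (is @ map uminus js) @ word_pow T r)
      = (set is \<union> uminus ` set js, r)"
    if "sorted_wrt (<) is" "\<forall>i\<in>set is. 0 < i" "sorted_wrt (<) js" "\<forall>j\<in>set js. 0 \<le> j"
  proof -
    \<comment> \<open>The sign conditions keep the two blocks disjoint, so no lamp is switched off
      again.\<close>
    have "distinct (is @ map uminus js)"
      using that by (fastforce simp: strict_sorted_iff distinct_map)
    then have "run ({}, 0) (lamps_word (is @ map uminus js)) = ({} \<union> set (is @ map uminus js), 0)"
      by (intro run_lamps_word) simp_all
    then show ?thesis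
      by (subst foldl_append) (simp only:, simp add: run_word_pow_T)
  qed
  ultimately show ?thesis
    unfolding is_normal_form_def by (auto simp: cls_eq_iff_run)
qed

lemma exists_normal_form: "\<exists>nf. is_normal_form (cls u) nf"
proof -
  obtain S p where run_u: "run ({}, 0) u = (S, p)" by (cases "run ({}, 0) u")
  then have "finite S" using finite_run[of "{}" 0 u] by simp
  \<comment> \<open>Lamp \<open>0\<close> goes to the second block, which stores negated indices;
    hence the double negation.\<close>
  moreover have "S = {k \<in> S. 0 < k} \<union> uminus ` uminus ` {k \<in> S. k \<le> 0}" by (auto simp: image_image)
  ultimately have "is_normal_form (cls u)
    (sorted_list_of_set {k \<in> S. 0 < k}, sorted_list_of_set (uminus ` {k \<in> S. k \<le> 0}), p)"
    by (auto simp: is_normal_form_cls_iff run_u)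
  then show ?thesis ..
qed

lemma normal_form_unique:
  assumes "is_normal_form (cls u) nf" "is_normal_form (cls u) nf'"
  shows "nf = nf'"
proof -
  \<comment> \<open>The sign of an index decides its block, so \<open>S\<close> determines both
    sets, and with them the strictly increasing lists.\<close>
  have *: "set is = {k \<in> S. 0 < k}" "set js = uminus ` {k \<in> S. k \<le> 0}"
    if "S = set is \<union> uminus ` set js" "\<forall>i\<in>set is. 0 < i" "\<forall>j\<in>set js. 0 \<le> j"
    for "is" js :: "int list" and S
    using that by (force simp: image_iff)+
  obtain "is" js r is' js' r' where nf: "nf = (is, js, r)" "nf' = (is', js', r')"
    by (cases nf; cases nf')
  note N = assms[unfolded nf is_normal_form_cls_iff]
  define S where "S = set is \<union> uminus ` set js"
  have S': "S = set is' \<union> uminus ` set js'" "r = r'" using N by (auto simp: S_def)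
  have sign: "\<forall>i\<in>set is. 0 < i" "\<forall>j\<in>set js. 0 \<le> j" "\<forall>i\<in>set is'. 0 < i" "\<forall>j\<in>set js'. 0 \<le> j"
    using N by blast+
  have "set is = set is'" "set js = set js'"
    using *[OF S_def sign(1,2)] *[OF S'(1) sign(3,4)] by simp_all
  then have "is = is'" "js = js'"
    using N strict_sorted_equal by blast+
  then show ?thesis by (simp add: nf S')
qed

lemma is_normal_form_normal_form: "is_normal_form (cls u) (normal_form (cls u))"
  unfolding normal_form_def
  using exists_normal_form normal_form_unique by (metis theI)


section \<open>Walks\<close>

text \<open>Words for \<open>t\<close>, \<open>ta\<close> and their inverses. In the inverse of
  \<open>ta\<close> the toggle precedes the move left, so both directions of crossing an edge act on
  the same lamp.\<close>

definition gen_words :: "lamp_gen word set" where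
  "gen_words = {[(T, True)], [(T, True), (A, True)], [(T, False)], [(A, False), (T, False)]}"

definition reach :: "nat \<Rightarrow> int set \<times> int \<Rightarrow> int set \<times> int \<Rightarrow> bool" where
  "reach n s s' \<longleftrightarrow> (\<exists>us. set us \<subseteq> gen_words \<and> length us = n \<and> run s (concat us) = s')"

lemma reach_0: "reach 0 s s' \<longleftrightarrow> s = s'"
  by (auto simp: reach_def)

lemma reach_trans:
  assumes "reach m s s'" "reach n s' s''"
  shows "reach (m + n) s s''"
proof -
  obtain us vs where "set us \<subseteq> gen_words" "length us = m" "run s (concat us) = s'"
    "set vs \<subseteq> gen_words" "length vs = n" "run s' (concat vs) = s''"
    using assms by (auto simp: reach_def)
  then show ?thesis
    unfolding reach_def by (intro exI[of _ "us @ vs"]) simp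
qed

lemma reach_1: "u \<in> gen_words \<Longrightarrow> reach 1 s (run s u)"
  unfolding reach_def by (rule exI[of _ "[u]"]) simp

text \<open>The last step crosses the edge of lamp \<open>p + n + 1\<close> and uses
  \<open>ta\<close> instead of \<open>t\<close> exactly if that lamp is in \<open>X\<close>.\<close>

lemma reach_right:
  "X \<subseteq> {p + 1..p + int n} \<Longrightarrow> reach n (S, p) (sym_diff S X, p + int n)"
proof (induction n arbitrary: X)
  case 0
  then show ?case by (simp add: reach_0)
next
  case (Suc n)
  let ?q = "p + int n + 1"
  let ?u = "if ?q \<in> X then [(T, True), (A, True)] else [(T, True)]"
  have "reach n (S, p) (sym_diff S (X - {?q}), p + int n)"
    using Suc.prems by (intro Suc.IH) fastforce
  moreover have "reach 1 \<dots> (run \<dots> ?u)"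
    by (rule reach_1) (simp add: gen_words_def)
  moreover have "run (sym_diff S (X - {?q}), p + int n) ?u = (sym_diff S X, ?q)"
    by auto
  ultimately have "reach (n + 1) (S, p) (sym_diff S X, ?q)"
    by (metis reach_trans)
  then show ?case by (simp add: algebra_simps)
qed

text \<open>Here the toggle comes before the move, so the range includes the starting position and
  excludes the final one.\<close>

lemma reach_left:
  "X \<subseteq> {p - int n + 1..p} \<Longrightarrow> reach n (S, p) (sym_diff S X, p - int n)"
proof (induction n arbitrary: X)
  case 0
  then show ?case by (simp add: reach_0)
next
  case (Suc n)
  let ?q = "p - int n"
  let ?u = "if ?q \<in> X then [(A, False), (T, False)] else [(T, False)]"
  have "reach n (S, p) (sym_diff S (X - {?q}), ?q)"
    using Suc.prems by (intro Suc.IH) fastforce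
  moreover have "reach 1 \<dots> (run \<dots> ?u)"
    by (rule reach_1) (simp add: gen_words_def)
  moreover have "run (sym_diff S (X - {?q}), ?q) ?u = (sym_diff S X, ?q - 1)"
    by auto
  ultimately have "reach (n + 1) (S, p) (sym_diff S X, ?q - 1)"
    by (metis reach_trans)
  then show ?case by (simp add: algebra_simps)
qed

lemma reach_right_to:
  "p \<le> q \<Longrightarrow> X \<subseteq> {p + 1..q} \<Longrightarrow> reach (nat (q - p)) (S, p) (sym_diff S X, q)"
  using reach_right[of X p "nat (q - p)" S] by simp

lemma reach_left_to:
  "q \<le> p \<Longrightarrow> X \<subseteq> {q + 1..p} \<Longrightarrow> reach (nat (p - q)) (S, p) (sym_diff S X, q)"
  using reach_left[of X p "nat (p - q)" S] by simp

lemma reach_move: "reach (nat \<bar>q - p\<bar>) (S, p) (S, q)"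
  using reach_right_to[of p q "{}" S] reach_left_to[of q p "{}" S] by (cases "p \<le> q") auto

text \<open>Length of a shortest walk from \<open>0\<close> to \<open>r\<close> that visits both \<open>I\<close> and \<open>- J\<close>.\<close>

definition tour :: "int \<Rightarrow> int \<Rightarrow> int \<Rightarrow> int" where
  "tour I J r = min (2 * J + I + \<bar>r - I\<bar>) (2 * I + J + \<bar>r + J\<bar>)"

text \<open>Raising \<open>I\<close> lowers the distance from \<open>r\<close> to \<open>I\<close>
  by at most the same amount, which the summand \<open>I\<close> makes up for; likewise for
  \<open>J\<close>.\<close>

lemma tour_mono: "I \<le> I' \<Longrightarrow> J \<le> J' \<Longrightarrow> tour I J r \<le> tour I' J' r"
  by (simp add: tour_def min_def) linarith

text \<open>Each term of the minimum is a walk: to one extreme, across to the other, then to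
  \<open>r\<close>. The lamps in \<open>?N\<close> and \<open>?P\<close> are set on the legs that
  run left and right of \<open>0\<close>, and the recrossed edges are passed without
  toggling.\<close>

lemma reach_tour:
  assumes "0 \<le> I" "0 \<le> J" "S \<subseteq> {1 - J..I}"
  shows "reach (nat (tour I J r)) ({}, 0) (S, r)"
proof -
  let ?P = "S \<inter> {1..I}" and ?N = "S \<inter> {1 - J..0}"
  have S: "sym_diff ?P ?N = S" "sym_diff ?N ?P = S" using assms by auto
  have "reach (nat (0 - (- J))) ({}, 0) (sym_diff {} ?N, - J)"
    using assms by (intro reach_left_to) auto
  moreover have "reach (nat (I - (- J))) (?N, - J) (sym_diff ?N ?P, I)"
    using assms by (intro reach_right_to) auto
  ultimately have "reach (nat J + nat (I + J) + nat \<bar>r - I\<bar>) ({}, 0) (S, r)"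
    using reach_move[of r I S] by (auto simp: S intro: reach_trans)
  moreover have "nat J + nat (I + J) + nat \<bar>r - I\<bar> = nat (2 * J + I + \<bar>r - I\<bar>)"
    using assms by simp
  ultimately have left_first: "reach (nat (2 * J + I + \<bar>r - I\<bar>)) ({}, 0) (S, r)" by simp
  have "reach (nat (I - 0)) ({}, 0) (sym_diff {} ?P, I)"
    using assms by (intro reach_right_to) auto
  moreover have "reach (nat (I - (- J))) (?P, I) (sym_diff ?P ?N, - J)"
    using assms by (intro reach_left_to) auto
  ultimately have "reach (nat I + nat (I + J) + nat \<bar>r - (- J)\<bar>) ({}, 0) (S, r)"
    using reach_move[of r "- J" S] by (auto simp: S intro: reach_trans)
  moreover have "nat I + nat (I + J) + nat \<bar>r - (- J)\<bar> = nat (2 * I + J + \<bar>r + J\<bar>)"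
    using assms by simp
  ultimately have "reach (nat (2 * I + J + \<bar>r + J\<bar>)) ({}, 0) (S, r)" by simp
  with left_first show ?thesis by (simp add: tour_def min_def)
qed

text \<open>Here \<open>I\<close> and \<open>- J\<close> are the extreme positions of the walk.\<close>

lemma tour_le_length:
  "set us \<subseteq> gen_words \<Longrightarrow> run ({}, 0) (concat us) = (S, r) \<Longrightarrow>
     \<exists>I J. 0 \<le> I \<and> 0 \<le> J \<and> - J \<le> r \<and> r \<le> I \<and> S \<subseteq> {1 - J..I} \<and> tour I J r \<le> int (length us)"
proof (induction us arbitrary: S r rule: rev_induct)
  case Nil
  then show ?case by (intro exI[of _ 0]) (simp add: tour_def)
next
  case (snoc u us)
  obtain S' r' where run_us: "run ({}, 0) (concat us) = (S', r')"
    by (cases "run ({}, 0) (concat us)")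
  with snoc obtain I J where IJ: "0 \<le> I" "0 \<le> J" "- J \<le> r'" "r' \<le> I" "S' \<subseteq> {1 - J..I}"
    "tour I J r' \<le> int (length us)"
    by (metis set_append le_sup_iff)
  have u: "u \<in> gen_words" using snoc.prems by simp
  have "run (S', r') u = (S, r)" using snoc.prems by (simp add: run_us)
  \<comment> \<open>The only lamp that can change belongs to the crossed edge, hence is the right
    endpoint of that edge.\<close>
  with u have r: "r = r' + 1 \<and> S \<subseteq> insert r S' \<or> r = r' - 1 \<and> S \<subseteq> insert r' S'"
    by (auto simp: gen_words_def)
  then have "S \<subseteq> {1 - max J (- r)..max I r}"
    using IJ by fastforce
  \<comment> \<open>Inside the old range only the last leg changes, by at most one. A new extreme
    arises only from standing on the old one, where the optimal tour simply gets one step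
    longer.\<close>
  moreover have "tour (max I r) (max J (- r)) r \<le> tour I J r' + 1"
  proof -
    have "r = r' + 1 \<or> r = r' - 1" using r by blast
    with IJ(1-4) show ?thesis unfolding tour_def by (smt (verit))
  qed
  ultimately show ?case
    using IJ by (intro exI[of _ "max I r"] exI[of _ "max J (- r)"]) auto
qed

section \<open>Word length as the length of a shortest walk\<close>

lemma word_length_eq_Least:
  "word_length lamplighter {gen_t, gen_t \<otimes>\<^bsub>lamplighter\<^esub> gen_a} (cls u) =
     (LEAST n. reach n ({}, 0) (run ({}, 0) u))"
proof -
  let ?X = "{gen_t, gen_t \<otimes>\<^bsub>lamplighter\<^esub> gen_a}"
  have gens: "?X \<union> m_inv lamplighter ` ?X = cls ` gen_words"
    by (auto simp: gen_t_def gen_a_def mult_cls inv_cls word_inv_def gen_words_def)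
  \<comment> \<open>A list of generators and inverses is lifted entry by entry to representing
    words.\<close>
  have "set xs \<subseteq> cls ` gen_words \<longleftrightarrow> (\<exists>us. set us \<subseteq> gen_words \<and> xs = map cls us)" for xs
    using arg_cong[OF lists_image[of cls gen_words], of "\<lambda>L. xs \<in> L"]
    by (simp only: lists_eq_set mem_Collect_eq image_iff Bex_def)
  then have "(\<exists>xs. set xs \<subseteq> cls ` gen_words \<and> length xs = n \<and>
        foldr (monoid.mult lamplighter) xs \<one>\<^bsub>lamplighter\<^esub> = cls u)
      \<longleftrightarrow> (\<exists>us. set us \<subseteq> gen_words \<and> length us = n \<and>
        foldr (monoid.mult lamplighter) (map cls us) \<one>\<^bsub>lamplighter\<^esub> = cls u)" for n
    by (metis (no_types, lifting) length_map)
  moreover have "(\<exists>us. set us \<subseteq> gen_words \<and> length us = n \<and>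
        foldr (monoid.mult lamplighter) (map cls us) \<one>\<^bsub>lamplighter\<^esub> = cls u)
      \<longleftrightarrow> reach n ({}, 0) (run ({}, 0) u)" for n
    by (simp add: one_cls foldr_mult_cls reach_def cls_eq_iff_run)
  ultimately show ?thesis unfolding word_length_def gens by simp
qed

text \<open>\<open>I\<close> and \<open>J\<close> are the least bounds enclosing the edges of all
  lit lamps. Any walk ending in this state has extremes at least as wide, so
  \<open>tour_mono\<close> gives the lower bound and \<open>reach_tour\<close> attains it.\<close>

lemma word_length_eq_tour:
  assumes run_u: "run ({}, 0) u = (S, r)"
    and IJ: "0 \<le> I" "0 \<le> J" "S \<subseteq> {1 - J..I}"
    and I_least: "\<And>I'. 0 \<le> I' \<Longrightarrow> S \<subseteq> {..I'} \<Longrightarrow> I \<le> I'"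
    and J_least: "\<And>J'. 0 \<le> J' \<Longrightarrow> S \<subseteq> {1 - J'..} \<Longrightarrow> J \<le> J'"
  shows "int (word_length lamplighter {gen_t, gen_t \<otimes>\<^bsub>lamplighter\<^esub> gen_a} (cls u)) = tour I J r"
proof -
  have "(LEAST n. reach n ({}, 0) (S, r)) = nat (tour I J r)"
  proof (rule Least_equality)
    show "reach (nat (tour I J r)) ({}, 0) (S, r)" using IJ by (rule reach_tour)
  next
    fix n assume "reach n ({}, 0) (S, r)"
    then obtain I' J' where "0 \<le> I'" "0 \<le> J'" "S \<subseteq> {1 - J'..I'}" "tour I' J' r \<le> int n"
      unfolding reach_def using tour_le_length by metis
    moreover from this have "I \<le> I'" "J \<le> J'"
      by (auto intro!: I_least J_least)
    ultimately show "nat (tour I J r) \<le> n"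
      using tour_mono[of I I' J J' r] by simp
  qed
  moreover have "0 \<le> tour I J r" using IJ by (simp add: tour_def)
  ultimately show ?thesis by (simp add: word_length_eq_Least run_u)
qed

lemma le_last:
  fixes xs :: "int list"
  assumes "sorted_wrt (<) xs" "x \<in> set xs"
  shows "x \<le> last xs"
  using assms by (induction xs) (auto simp: less_imp_le)

theorem proposition2p4:
  assumes "w \<in> carrier lamplighter"
  shows "int (word_length lamplighter {gen_t, gen_t \<otimes>\<^bsub>lamplighter\<^esub> gen_a} w) = D' w"
proof -
  obtain u where w: "w = cls u"
    using assms by (auto simp: lamplighter_def carrier_presented_group)
  obtain "is" js r where nf: "normal_form w = (is, js, r)" by (cases "normal_form w")
  then have "is_normal_form (cls u) (is, js, r)"
    using is_normal_form_normal_form[of u] by (simp add: w)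
  then have sorted: "sorted_wrt (<) is" "sorted_wrt (<) js"
    and sign: "\<forall>i\<in>set is. 0 < i" "\<forall>j\<in>set js. 0 \<le> j"
    and run_u: "run ({}, 0) u = (set is \<union> uminus ` set js, r)"
    by (auto simp: is_normal_form_cls_iff)
  define I where "I = (if is = [] then 0 else last is)"
  \<comment> \<open>Lamp \<open>-j\<close> sits on the edge from \<open>-j - 1\<close> to
    \<open>-j\<close>, so the walk must get to \<open>-(j + 1)\<close>. With no such lamp the bound
    is \<open>0\<close>, not \<open>1\<close>.\<close>
  define J where "J = (if js = [] then 0 else last js + 1)"
  have nonneg: "0 \<le> I" "0 \<le> J" using sign by (auto simp: I_def J_def less_imp_le)
  have I: "i \<le> I" if "i \<in> set is" for i
    using that le_last[OF sorted(1)] by (auto simp: I_def)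
  have J: "j + 1 \<le> J" if "j \<in> set js" for j
    using that le_last[OF sorted(2)] by (auto simp: J_def)
  have "int (word_length lamplighter {gen_t, gen_t \<otimes>\<^bsub>lamplighter\<^esub> gen_a} w) = tour I J r"
    unfolding w
  proof (rule word_length_eq_tour[OF run_u nonneg])
    show "set is \<union> uminus ` set js \<subseteq> {1 - J..I}"
      using nonneg sign I J by fastforce
    show "I \<le> I'" if "0 \<le> I'" "set is \<union> uminus ` set js \<subseteq> {..I'}" for I'
      using that by (auto simp: I_def dest: subsetD[OF _ last_in_set])
    show "J \<le> J'" if "0 \<le> J'" "set is \<union> uminus ` set js \<subseteq> {1 - J'..}" for J'
      using that by (auto simp: J_def dest: subsetD[OF _ imageI[OF last_in_set]])
  qed
  also have "\<dots> = D' w"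
    \<comment> \<open>For \<open>js = []\<close> we have \<open>J = 0\<close>, and the triangle
      inequality makes the first term of \<open>tour\<close> the minimum.\<close>
    using nonneg unfolding D'_def nf
    by (auto simp: tour_def I_def J_def Let_def min_def)
  finally show ?thesis .
qed

end
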